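(* Let $M$ be a smooth closed manifold with a measure $d\sigma$ satisfying $\int_M d\sigma=1$, and let $B:C^\infty(M)\to C^\infty(M)$ be a non-negative self-adjoint (with respect to $d\sigma$) linear operator whose null space is equal to the constant functions, and which is invertible on the orthogonal complement of the constants. Let $\alpha$ be a smooth function on $M$ and let $\beta>0$ be a constant. The following two statements are equivalent. (a) For all $F\in C^\infty(M)$ with $F>0$ and $\int_M F\,d\sigma=1$, $$\frac{\beta}{2}\int_M F B^{-2}F\,d\sigma\ \le\ \int_M F\log F\,d\sigma+\int_M F\alpha\,d\sigma.$$ (b) For all $u\in C^\infty(M)$, $$\frac{1}{2\beta}\int_M uB^2u\,d\sigma\ \ge\ \log\int_M e^{u-\alpha}\,d\sigma-\int_M u\,d\sigma.$$
   Context: "Closed" means compact without boundary. All functions are real-valued. $B^{-1}$ denotes the linear operator equal to the inverse of $B$ on the orthogonal complement of the constants (in $C^\infty(M)$ with the inner product $\int_M uv\,d\sigma$) and equal to $0$ on constants; $B^{-2}=(B^{-1})^2$. *)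

theory Defs
  imports "HOL-Probability.Probability"
begin

section \<open>Smooth functions and smooth manifolds\<close>

text \<open>
  The model space is the library's \<open>Euclidean_space n\<close>: sequences of reals vanishing
  from index \<open>n\<close> on, with the product topology. Since \<open>n\<close> is a term, dimension 0 is included.
  For an open subset \<open>S\<close> of it, \<open>Ck_on n k S f\<close> says that all iterated partial derivatives
  of \<open>f\<close> of order at most \<open>k\<close> exist and are continuous on \<open>S\<close>. Values of \<open>f\<close> outside
  \<open>S\<close> are irrelevant, as \<open>x(i := t)\<close> lies in \<open>S\<close> for \<open>t\<close> close to \<open>x i\<close>.
\<close>

primrec Ck_on :: "nat \<Rightarrow> nat \<Rightarrow> (nat \<Rightarrow> real) set \<Rightarrow> ((nat \<Rightarrow> real) \<Rightarrow> real) \<Rightarrow> bool" where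
  "Ck_on n 0 S f \<longleftrightarrow> continuous_map (subtopology (Euclidean_space n) S) euclideanreal f"
| "Ck_on n (Suc k) S f \<longleftrightarrow>
     continuous_map (subtopology (Euclidean_space n) S) euclideanreal f \<and>
     (\<forall>i<n. \<exists>g. Ck_on n k S g \<and>
        (\<forall>x\<in>S. ((\<lambda>t. f (x(i := t))) has_real_derivative g x) (at (x i))))"

definition smooth_on :: "nat \<Rightarrow> (nat \<Rightarrow> real) set \<Rightarrow> ((nat \<Rightarrow> real) \<Rightarrow> real) \<Rightarrow> bool" where
  "smooth_on n S f \<longleftrightarrow> (\<forall>k. Ck_on n k S f)"

type_synonym 'a chart = "'a set \<times> ('a \<Rightarrow> nat \<Rightarrow> real)"

definition is_chart :: "nat \<Rightarrow> 'a::topological_space chart \<Rightarrow> bool" where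
  "is_chart n = (\<lambda>(U, \<phi>). open U \<and> openin (Euclidean_space n) (\<phi> ` U) \<and>
     homeomorphic_map (top_of_set U) (subtopology (Euclidean_space n) (\<phi> ` U)) \<phi>)"

definition smooth_transition :: "nat \<Rightarrow> 'a chart \<Rightarrow> 'a chart \<Rightarrow> bool" where
  "smooth_transition n = (\<lambda>(U, \<phi>) (V, \<psi>).
     \<forall>i<n. smooth_on n (\<phi> ` (U \<inter> V)) (\<lambda>x. \<psi> (inv_into U \<phi> x) i))"

definition smooth_atlas :: "nat \<Rightarrow> 'a::topological_space chart set \<Rightarrow> bool" where
  "smooth_atlas n \<A> \<longleftrightarrow>
     (\<forall>c\<in>\<A>. is_chart n c) \<and> (\<Union>c\<in>\<A>. fst c) = UNIV \<and>
     (\<forall>c\<in>\<A>. \<forall>d\<in>\<A>. smooth_transition n c d)"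

text \<open>
  The underlying set of the manifold is the whole type. The sort \<open>t2_space\<close> supplies the
  Hausdorff property; second countability follows from compactness and the charts. Nothing
  forces connectedness. The atlas need not be maximal: \<open>C_infinity\<close> below is the same for
  all atlases of one smooth structure.
\<close>

definition smooth_closed_manifold :: "nat \<Rightarrow> 'a::t2_space chart set \<Rightarrow> bool" where
  "smooth_closed_manifold n \<A> \<longleftrightarrow> compact (UNIV :: 'a set) \<and> smooth_atlas n \<A>"

definition C_infinity :: "nat \<Rightarrow> 'a chart set \<Rightarrow> ('a \<Rightarrow> real) set" where
  "C_infinity n \<A> = {f. \<forall>(U, \<phi>)\<in>\<A>. smooth_on n (\<phi> ` U) (\<lambda>x. f (inv_into U \<phi> x))}"


section \<open>Operators on a function space\<close>

definition linear_operator_on ::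
  "('a \<Rightarrow> real) set \<Rightarrow> (('a \<Rightarrow> real) \<Rightarrow> ('a \<Rightarrow> real)) \<Rightarrow> bool" where
  "linear_operator_on E L \<longleftrightarrow>
     (\<forall>u\<in>E. L u \<in> E) \<and>
     (\<forall>u\<in>E. \<forall>v\<in>E. L (\<lambda>x. u x + v x) = (\<lambda>x. L u x + L v x)) \<and>
     (\<forall>c. \<forall>u\<in>E. L (\<lambda>x. c * u x) = (\<lambda>x. c * L u x))"

definition self_adjoint_on ::
  "'a measure \<Rightarrow> ('a \<Rightarrow> real) set \<Rightarrow> (('a \<Rightarrow> real) \<Rightarrow> ('a \<Rightarrow> real)) \<Rightarrow> bool" where
  "self_adjoint_on \<sigma> E L \<longleftrightarrow>
     (\<forall>u\<in>E. \<forall>v\<in>E. (LINT x|\<sigma>. L u x * v x) = (LINT x|\<sigma>. u x * L v x))"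

definition non_negative_on ::
  "'a measure \<Rightarrow> ('a \<Rightarrow> real) set \<Rightarrow> (('a \<Rightarrow> real) \<Rightarrow> ('a \<Rightarrow> real)) \<Rightarrow> bool" where
  "non_negative_on \<sigma> E L \<longleftrightarrow> (\<forall>u\<in>E. (LINT x|\<sigma>. u x * L u x) \<ge> 0)"

definition constants_perp :: "'a measure \<Rightarrow> ('a \<Rightarrow> real) set \<Rightarrow> ('a \<Rightarrow> real) set" where
  "constants_perp \<sigma> E = {u \<in> E. \<forall>c. (LINT x|\<sigma>. u x * c) = 0}"

text \<open>
  On a probability space \<open>u\<close> is the sum of the constant \<open>\<integral>u d\<sigma>\<close> and of
  \<open>u - \<integral>u d\<sigma>\<close>, which is orthogonal to the constants. So the linear operator that is 0 on
  constants and inverts \<open>B\<close> on their orthogonal complement is given as follows; the three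
  lemmas after the definition confirm that it has these properties.
\<close>

definition inverse_mod_constants ::
  "'a measure \<Rightarrow> ('a \<Rightarrow> real) set \<Rightarrow> (('a \<Rightarrow> real) \<Rightarrow> ('a \<Rightarrow> real)) \<Rightarrow>
   ('a \<Rightarrow> real) \<Rightarrow> ('a \<Rightarrow> real)" where
  "inverse_mod_constants \<sigma> E B u =
     the_inv_into (constants_perp \<sigma> E) B (\<lambda>x. u x - (LINT y|\<sigma>. u y))"

lemma inverse_mod_constants_perp:
  assumes "u \<in> constants_perp \<sigma> E"
  shows "inverse_mod_constants \<sigma> E B u = the_inv_into (constants_perp \<sigma> E) B u"
proof -
  have "(LINT x|\<sigma>. u x * 1) = 0"
    using assms unfolding constants_perp_def by blast
  then show ?thesis
    by (simp add: inverse_mod_constants_def)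
qed

lemma inverse_mod_constants_const:
  assumes "prob_space \<sigma>"
    and "(\<lambda>_. 0) \<in> E" and "B (\<lambda>_. 0) = (\<lambda>_. 0)"
    and "inj_on B (constants_perp \<sigma> E)"
  shows "inverse_mod_constants \<sigma> E B (\<lambda>_. c) = (\<lambda>_. 0)"
proof -
  interpret prob_space \<sigma> by fact
  have "(\<lambda>_. 0) \<in> constants_perp \<sigma> E"
    using assms(2) by (simp add: constants_perp_def)
  then have "the_inv_into (constants_perp \<sigma> E) B (\<lambda>_. 0) = (\<lambda>_. 0)"
    using assms(3,4) the_inv_into_f_f by fastforce
  then show ?thesis
    by (simp add: inverse_mod_constants_def prob_space)
qed

lemma linear_inverse_mod_constants:
  assumes "prob_space \<sigma>"
    and int: "\<And>u. u \<in> E \<Longrightarrow> integrable \<sigma> u"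
    and const: "\<And>c. (\<lambda>_. c) \<in> E"
    and add: "\<And>u v. u \<in> E \<Longrightarrow> v \<in> E \<Longrightarrow> (\<lambda>x. u x + v x) \<in> E"
    and scale: "\<And>c u. u \<in> E \<Longrightarrow> (\<lambda>x. c * u x) \<in> E"
    and lin: "linear_operator_on E B"
    and bij: "bij_betw B (constants_perp \<sigma> E) (constants_perp \<sigma> E)"
  shows "linear_operator_on E (inverse_mod_constants \<sigma> E B)"
proof -
  interpret prob_space \<sigma> by fact
  let ?P = "constants_perp \<sigma> E"
  let ?L = "inverse_mod_constants \<sigma> E B"
  let ?pr = "\<lambda>u x. u x - (LINT y|\<sigma>. u y)"
  have P_iff: "u \<in> ?P \<longleftrightarrow> u \<in> E \<and> (LINT x|\<sigma>. u x) = 0" for u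
    unfolding constants_perp_def by (auto dest: spec[where x = 1])
  have pr: "?pr u \<in> ?P" if "u \<in> E" for u
    using add[OF that const[of "- (LINT y|\<sigma>. u y)"]] int[OF that]
    by (simp add: P_iff prob_space)
  have inj: "inj_on B ?P" and im: "B ` ?P = ?P"
    using bij by (auto simp: bij_betw_def)
  have L: "?L u \<in> ?P" "B (?L u) = ?pr u" if "u \<in> E" for u
    unfolding inverse_mod_constants_def
    using pr[OF that] the_inv_into_into[OF inj, of "?pr u" ?P] f_the_inv_into_f[OF inj, of "?pr u"] im
    by auto
  have eq: "?L u = w" if "u \<in> E" "w \<in> ?P" "B w = ?pr u" for u w
    using inj_onD[OF inj] L[OF that(1)] that by metis
  show ?thesis
    unfolding linear_operator_on_def
  proof (intro conjI ballI allI)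
    fix u assume u: "u \<in> E"
    show "?L u \<in> E" using L(1)[OF u] P_iff by blast
  next
    fix u v assume u: "u \<in> E" and v: "v \<in> E"
    have E: "?L u \<in> E" "?L v \<in> E" using L(1) u v P_iff by auto
    show "?L (\<lambda>x. u x + v x) = (\<lambda>x. ?L u x + ?L v x)"
    proof (rule eq)
      show "(\<lambda>x. ?L u x + ?L v x) \<in> ?P"
        using L(1)[OF u] L(1)[OF v] int E add by (simp add: P_iff)
      have "B (\<lambda>x. ?L u x + ?L v x) = (\<lambda>x. B (?L u) x + B (?L v) x)"
        using lin E by (simp add: linear_operator_on_def)
      then show "B (\<lambda>x. ?L u x + ?L v x) = ?pr (\<lambda>x. u x + v x)"
        using L(2) u v int by (simp add: fun_eq_iff)
    qed (use add u v in auto)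
  next
    fix c u assume u: "u \<in> E"
    have E: "?L u \<in> E" using L(1) u P_iff by auto
    show "?L (\<lambda>x. c * u x) = (\<lambda>x. c * ?L u x)"
    proof (rule eq)
      show "(\<lambda>x. c * ?L u x) \<in> ?P"
        using L(1)[OF u] E scale by (simp add: P_iff)
      have "B (\<lambda>x. c * ?L u x) = (\<lambda>x. c * B (?L u) x)"
        using lin E by (simp add: linear_operator_on_def)
      then show "B (\<lambda>x. c * ?L u x) = ?pr (\<lambda>x. c * u x)"
        using L(2) u by (simp add: fun_eq_iff right_diff_distrib)
    qed (use scale u in auto)
  qed
qed

end

theory Submission
  imports Defs
begin

text \<open>
  The two inequalities are exchanged by convex duality, each of the two sides by its own Legendre
  transform. Write \<open>v = u - \<alpha>\<close>.

  \<^item> The entropy \<open>\<integral>F log F\<close> of a positive \<open>F\<close> of integral 1 and the functional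
    \<open>log \<integral>e\<^sup>v\<close> are conjugate: \<open>\<integral>F (v - log F) \<le> log \<integral>e\<^sup>v\<close>, with equality
    for the Gibbs density \<open>F = e\<^sup>v / \<integral>e\<^sup>v\<close> (lemmas \<open>gibbs_inequality\<close> and
    \<open>gibbs_density_equality\<close>).
  \<^item> The quadratic forms are conjugate: \<open>\<integral>F u - \<integral>u \<le> \<beta>/2 \<integral>F B\<^sup>-\<^sup>2 F + 1/(2\<beta>) \<integral>u B\<^sup>2 u\<close>,
    with equality for \<open>u = \<beta> B\<^sup>-\<^sup>2 F\<close> (lemmas \<open>quadratic_duality\<close> and
    \<open>quadratic_duality_equality\<close>). Since \<open>\<integral>F = 1\<close>, the function \<open>F - 1\<close> equals
    \<open>B (B\<^sup>-\<^sup>1 F)\<close>, so the left side is \<open>\<integral>B\<^sup>-\<^sup>1F \<cdot> B u\<close> and Young's inequality applies.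

  Given \<open>u\<close>, the exponential inequality (b) follows from (a) for the Gibbs density \<open>F\<close> of
  \<open>u - \<alpha>\<close> together with the bound on the quadratic forms. Given \<open>F\<close>, the entropy inequality (a)
  follows from (b) for \<open>u = \<beta> B\<^sup>-\<^sup>2 F\<close> together with the bound on the entropy.

  What remains is regularity. The Gibbs density must again be a smooth function, so smooth functions
  have to be closed under sums, products and the exponential. All integrands are continuous on a
  compact space and therefore integrable.
\<close>

section \<open>Algebra and continuity of smooth functions\<close>

lemma Ck_on_SucE:
  assumes "Ck_on n (Suc k) S f" "i < n"
  obtains g where "Ck_on n k S g"
    and "\<And>x. x \<in> S \<Longrightarrow> ((\<lambda>t. f (x(i := t))) has_real_derivative g x) (at (x i))"
  using assms by auto

lemma Ck_on_SucD: "Ck_on n (Suc k) S f \<Longrightarrow> Ck_on n k S f"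
proof (induction k arbitrary: f)
  case (Suc k)
  have "\<exists>g. Ck_on n k S g \<and>
      (\<forall>x\<in>S. ((\<lambda>t. f (x(i := t))) has_real_derivative g x) (at (x i)))" if "i < n" for i
    using Ck_on_SucE[OF Suc.prems that] Suc.IH by metis
  with Suc.prems show ?case by simp
qed simp

lemma Ck_on_const: "Ck_on n k S (\<lambda>x. c)"
proof (induction k arbitrary: c)
  case (Suc k)
  have "((\<lambda>t. c) has_real_derivative 0) F" for F :: "real filter"
    by simp
  with Suc show ?case
    by (auto intro!: exI[of _ "\<lambda>x. 0"])
qed simp

lemma Ck_on_add: "Ck_on n k S f \<Longrightarrow> Ck_on n k S g \<Longrightarrow> Ck_on n k S (\<lambda>x. f x + g x)"
proof (induction k arbitrary: f g)
  case 0
  then show ?case by (simp add: continuous_map_add)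
next
  case (Suc k)
  have "\<exists>h. Ck_on n k S h \<and> (\<forall>x\<in>S.
      ((\<lambda>t. f (x(i := t)) + g (x(i := t))) has_real_derivative h x) (at (x i)))" if "i < n" for i
  proof -
    obtain f' where "Ck_on n k S f'"
      and "\<And>x. x \<in> S \<Longrightarrow> ((\<lambda>t. f (x(i := t))) has_real_derivative f' x) (at (x i))"
      using Ck_on_SucE[OF Suc.prems(1) \<open>i < n\<close>] by blast
    moreover obtain g' where "Ck_on n k S g'"
      and "\<And>x. x \<in> S \<Longrightarrow> ((\<lambda>t. g (x(i := t))) has_real_derivative g' x) (at (x i))"
      using Ck_on_SucE[OF Suc.prems(2) \<open>i < n\<close>] by blast
    ultimately show ?thesis
      by (intro exI[of _ "\<lambda>x. f' x + g' x"]) (auto intro: Suc.IH DERIV_add)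
  qed
  with Suc.prems show ?case by (simp add: continuous_map_add)
qed

lemma Ck_on_mult: "Ck_on n k S f \<Longrightarrow> Ck_on n k S g \<Longrightarrow> Ck_on n k S (\<lambda>x. f x * g x)"
proof (induction k arbitrary: f g)
  case 0
  then show ?case by (simp add: continuous_map_real_mult)
next
  case (Suc k)
  have "\<exists>h. Ck_on n k S h \<and> (\<forall>x\<in>S.
      ((\<lambda>t. f (x(i := t)) * g (x(i := t))) has_real_derivative h x) (at (x i)))" if "i < n" for i
  proof -
    obtain f' where Cf': "Ck_on n k S f'"
      and f': "\<And>x. x \<in> S \<Longrightarrow> ((\<lambda>t. f (x(i := t))) has_real_derivative f' x) (at (x i))"
      using Ck_on_SucE[OF Suc.prems(1) \<open>i < n\<close>] by blast
    obtain g' where Cg': "Ck_on n k S g'"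
      and g': "\<And>x. x \<in> S \<Longrightarrow> ((\<lambda>t. g (x(i := t))) has_real_derivative g' x) (at (x i))"
      using Ck_on_SucE[OF Suc.prems(2) \<open>i < n\<close>] by blast
    have "Ck_on n k S (\<lambda>x. f' x * g x + g' x * f x)"
      using Suc.prems[THEN Ck_on_SucD] Cf' Cg' by (intro Ck_on_add Suc.IH)
    moreover have "((\<lambda>t. f (x(i := t)) * g (x(i := t))) has_real_derivative
        f' x * g x + g' x * f x) (at (x i))" if "x \<in> S" for x
      using DERIV_mult[OF f'[OF that] g'[OF that]] by simp
    ultimately show ?thesis by blast
  qed
  with Suc.prems show ?case by (simp add: continuous_map_real_mult)
qed

text \<open>
  The exponential is its own derivative, so the chain rule expresses the partial derivatives of
  \<open>exp f\<close> as products \<open>exp f \<cdot> f'\<close> and the induction closes.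
\<close>

lemma Ck_on_exp: "Ck_on n k S f \<Longrightarrow> Ck_on n k S (\<lambda>x. exp (f x))"
proof -
  have cont: "continuous_map X euclideanreal (\<lambda>x. exp (f x))"
    if "continuous_map X euclideanreal f" for X and f :: "(nat \<Rightarrow> real) \<Rightarrow> real"
    using continuous_map_compose[OF that, of euclideanreal exp]
    by (simp add: comp_def continuous_on_exp)
  show "Ck_on n k S f \<Longrightarrow> Ck_on n k S (\<lambda>x. exp (f x))"
  proof (induction k)
    case 0
    then show ?case by (simp add: cont)
  next
    case (Suc k)
    have "\<exists>h. Ck_on n k S h \<and> (\<forall>x\<in>S.
        ((\<lambda>t. exp (f (x(i := t)))) has_real_derivative h x) (at (x i)))" if "i < n" for i
    proof -
      obtain f' where *: "Ck_on n k S f'"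
        and f': "\<And>x. x \<in> S \<Longrightarrow> ((\<lambda>t. f (x(i := t))) has_real_derivative f' x) (at (x i))"
        using Ck_on_SucE[OF Suc.prems \<open>i < n\<close>] by blast
      have "Ck_on n k S (\<lambda>x. exp (f x) * f' x)"
        using Ck_on_SucD[OF Suc.prems] * by (intro Ck_on_mult Suc.IH)
      moreover have "((\<lambda>t. exp (f (x(i := t)))) has_real_derivative exp (f x) * f' x) (at (x i))"
        if "x \<in> S" for x
        using DERIV_fun_exp[OF f'[OF that]] by simp
      ultimately show ?thesis by blast
    qed
    with Suc.prems show ?case by (simp add: cont)
  qed
qed

lemma C_infinity_const: "(\<lambda>x. c) \<in> C_infinity n \<A>"
  by (auto simp: C_infinity_def smooth_on_def Ck_on_const)

lemma C_infinity_add: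
  "f \<in> C_infinity n \<A> \<Longrightarrow> g \<in> C_infinity n \<A> \<Longrightarrow> (\<lambda>x. f x + g x) \<in> C_infinity n \<A>"
  by (fastforce simp: C_infinity_def smooth_on_def intro: Ck_on_add)

lemma C_infinity_mult:
  "f \<in> C_infinity n \<A> \<Longrightarrow> g \<in> C_infinity n \<A> \<Longrightarrow> (\<lambda>x. f x * g x) \<in> C_infinity n \<A>"
  by (fastforce simp: C_infinity_def smooth_on_def intro: Ck_on_mult)

lemma C_infinity_exp: "f \<in> C_infinity n \<A> \<Longrightarrow> (\<lambda>x. exp (f x)) \<in> C_infinity n \<A>"
  by (fastforce simp: C_infinity_def smooth_on_def intro: Ck_on_exp)

text \<open>
  Smoothness speaks only of coordinate representations. Composing one with its chart recovers the
  function on the chart domain, and these domains form an open cover.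
\<close>

lemma C_infinity_continuous:
  assumes "smooth_atlas n \<A>" "f \<in> C_infinity n \<A>"
  shows "continuous_on UNIV f"
proof -
  have "continuous_on U f" if c: "(U, \<phi>) \<in> \<A>" for U \<phi>
  proof -
    have hom: "homeomorphic_map (top_of_set U) (subtopology (Euclidean_space n) (\<phi> ` U)) \<phi>"
      using assms(1) c by (auto simp: smooth_atlas_def is_chart_def)
    have "smooth_on n (\<phi> ` U) (\<lambda>x. f (inv_into U \<phi> x))"
      using assms(2) c by (auto simp: C_infinity_def)
    then have "continuous_map (subtopology (Euclidean_space n) (\<phi> ` U)) euclideanreal
        (\<lambda>x. f (inv_into U \<phi> x))"
      unfolding smooth_on_def by (metis Ck_on.simps(1))
    then have "continuous_map (top_of_set U) euclideanreal ((\<lambda>x. f (inv_into U \<phi> x)) \<circ> \<phi>)"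
      using continuous_map_compose homeomorphic_imp_continuous_map[OF hom] by blast
    moreover have "inj_on \<phi> U"
      using homeomorphic_imp_injective_map[OF hom] by simp
    ultimately show ?thesis
      by (auto simp: comp_def cong: continuous_on_cong)
  qed
  moreover have "open (fst c)" if "c \<in> \<A>" for c
    using assms(1) that by (auto simp: smooth_atlas_def is_chart_def)
  ultimately have "continuous_on (\<Union>c\<in>\<A>. fst c) f"
    by (intro continuous_on_open_UN) auto
  then show ?thesis
    using assms(1) by (simp add: smooth_atlas_def)
qed

lemma integrable_continuous_compact:
  fixes M :: "'a::topological_space measure" and f :: "'a \<Rightarrow> real"
  assumes "finite_measure M" "compact (UNIV :: 'a set)" "sets M = sets borel" "continuous_on UNIV f"
  shows "integrable M f"
proof -
  interpret finite_measure M by fact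
  have "f \<in> borel_measurable M"
    using borel_measurable_continuous_onI[OF assms(4)] measurable_cong_sets[OF assms(3) refl]
    by blast
  moreover have "bounded (range f)"
    using assms(2,4) compact_continuous_image compact_imp_bounded by blast
  then obtain C where "\<And>x. norm (f x) \<le> C"
    by (auto simp: bounded_iff)
  ultimately show ?thesis
    by (intro integrable_const_bound[of _ C]) auto
qed


section \<open>Duality of entropy and the logarithm of the exponential integral\<close>

lemma (in prob_space) integral_exp_pos:
  assumes "integrable M (\<lambda>x. exp (v x :: real))"
  shows "(LINT x|M. exp (v x)) > 0"
proof -
  have "(LINT x|M. exp (v x)) \<noteq> 0"
    using integral_nonneg_eq_0_iff_AE[OF assms] by simp
  then show ?thesis
    by (simp add: order_less_le)
qed

text \<open>
  Jensen's inequality for the measure \<open>F d\<sigma>\<close>, in the form \<open>log t \<le> t - 1\<close> with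
  \<open>t = e\<^sup>v / (F \<integral>e\<^sup>v)\<close>.
\<close>

lemma (in prob_space) gibbs_inequality:
  fixes F v :: "'a \<Rightarrow> real"
  assumes pos: "\<And>x. F x > 0" and F1: "(LINT x|M. F x) = 1"
    and int: "integrable M F" "integrable M (\<lambda>x. F x * v x)" "integrable M (\<lambda>x. F x * ln (F x))"
      "integrable M (\<lambda>x. exp (v x))"
  shows "(LINT x|M. F x * v x) - (LINT x|M. F x * ln (F x)) \<le> ln (LINT x|M. exp (v x))"
proof -
  define Z where "Z = (LINT x|M. exp (v x))"
  have Z: "Z > 0"
    unfolding Z_def by (rule integral_exp_pos[OF int(4)])
  have "F x * v x - F x * ln (F x) - F x * ln Z \<le> exp (v x) / Z - F x" for x
  proof -
    have "ln (exp (v x) / (F x * Z)) \<le> exp (v x) / (F x * Z) - 1"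
      using pos[of x] Z by (intro ln_le_minus_one) simp
    then have "F x * ln (exp (v x) / (F x * Z)) \<le> F x * (exp (v x) / (F x * Z) - 1)"
      using pos[of x] by (intro mult_left_mono) auto
    moreover have "ln (exp (v x) / (F x * Z)) = v x - ln (F x) - ln Z"
      using pos[of x] Z by (simp add: ln_div ln_mult)
    moreover have "F x * (exp (v x) / (F x * Z) - 1) = exp (v x) / Z - F x"
      using pos[of x] Z by (simp add: field_simps)
    ultimately show ?thesis
      by (simp add: right_diff_distrib)
  qed
  then have "(LINT x|M. F x * v x - F x * ln (F x) - F x * ln Z) \<le> (LINT x|M. exp (v x) / Z - F x)"
    using int by (intro integral_mono) auto
  also have "\<dots> = 0"
    using int Z F1 by (simp add: Z_def[symmetric])
  finally show ?thesis
    using int F1 by (simp add: Z_def[symmetric])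
qed

text \<open>
  The normalization sits inside the exponential: this makes \<open>log F = v - log \<integral>e\<^sup>v\<close> immediate,
  and \<open>F\<close> is smooth as the exponential of a smooth function.
\<close>

lemma (in prob_space) gibbs_density_equality:
  fixes F v :: "'a \<Rightarrow> real"
  assumes F_def: "F = (\<lambda>x. exp (v x - ln (LINT x|M. exp (v x))))"
    and int: "integrable M (\<lambda>x. exp (v x))" "integrable M (\<lambda>x. F x * v x)"
  shows "(LINT x|M. F x) = 1"
    and "(LINT x|M. F x * ln (F x)) = (LINT x|M. F x * v x) - ln (LINT x|M. exp (v x))"
proof -
  define Z where "Z = (LINT x|M. exp (v x))"
  have Z: "Z > 0"
    unfolding Z_def by (rule integral_exp_pos[OF int(1)])
  have F: "F = (\<lambda>x. exp (v x) / Z)"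
    using Z by (simp add: F_def exp_diff flip: Z_def)
  show F1: "(LINT x|M. F x) = 1"
    using Z by (simp add: F flip: Z_def)
  have intF: "integrable M F"
    unfolding F using int(1) by simp
  have "(LINT x|M. F x * ln (F x)) = (LINT x|M. F x * v x - F x * ln Z)"
    by (simp add: F_def right_diff_distrib flip: Z_def)
  also have "\<dots> = (LINT x|M. F x * v x) - ln Z"
    using int(2) intF F1 by simp
  finally show "(LINT x|M. F x * ln (F x)) = (LINT x|M. F x * v x) - ln (LINT x|M. exp (v x))"
    by (simp add: Z_def)
qed


section \<open>Duality of the quadratic forms\<close>

text \<open>
  The setting for the second duality. Closure of \<open>E\<close> under products makes all pairings
  \<open>\<integral>u v d\<sigma>\<close> of members of \<open>E\<close> integrals of integrable functions, so that they are bilinear.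
\<close>

locale invertible_mod_constants = prob_space \<sigma> for \<sigma> :: "'a measure" +
  fixes E :: "('a \<Rightarrow> real) set" and B :: "('a \<Rightarrow> real) \<Rightarrow> 'a \<Rightarrow> real"
  assumes const: "(\<lambda>x. c) \<in> E"
    and add: "u \<in> E \<Longrightarrow> v \<in> E \<Longrightarrow> (\<lambda>x. u x + v x) \<in> E"
    and mult: "u \<in> E \<Longrightarrow> v \<in> E \<Longrightarrow> (\<lambda>x. u x * v x) \<in> E"
    and integrable: "u \<in> E \<Longrightarrow> integrable \<sigma> u"
    and linear: "linear_operator_on E B"
    and self_adjoint: "self_adjoint_on \<sigma> E B"
    and bij: "bij_betw B (constants_perp \<sigma> E) (constants_perp \<sigma> E)"
begin

abbreviation Binv where "Binv \<equiv> inverse_mod_constants \<sigma> E B"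

lemma constants_perp_iff: "u \<in> constants_perp \<sigma> E \<longleftrightarrow> u \<in> E \<and> (LINT x|\<sigma>. u x) = 0"
  unfolding constants_perp_def by (auto dest: spec[where x = 1])

lemma B_in: "u \<in> E \<Longrightarrow> B u \<in> E"
  using linear by (auto simp: linear_operator_on_def)

lemma B_scale: "u \<in> E \<Longrightarrow> B (\<lambda>x. c * u x) = (\<lambda>x. c * B u x)"
  using linear by (auto simp: linear_operator_on_def)

lemma B_adjoint: "u \<in> E \<Longrightarrow> v \<in> E \<Longrightarrow> (LINT x|\<sigma>. B u x * v x) = (LINT x|\<sigma>. u x * B v x)"
  using self_adjoint by (auto simp: self_adjoint_on_def)

lemma Binv:
  assumes "u \<in> E"
  shows Binv_in: "Binv u \<in> E"
    and Binv_mean: "(LINT x|\<sigma>. Binv u x) = 0"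
    and B_Binv: "B (Binv u) = (\<lambda>x. u x - (LINT x|\<sigma>. u x))"
proof -
  have inj: "inj_on B (constants_perp \<sigma> E)" and im: "B ` constants_perp \<sigma> E = constants_perp \<sigma> E"
    using bij by (auto simp: bij_betw_def)
  have p: "(\<lambda>x. u x - (LINT x|\<sigma>. u x)) \<in> constants_perp \<sigma> E"
    using add[OF assms const[of "- (LINT x|\<sigma>. u x)"]] integrable[OF assms]
    by (simp add: constants_perp_iff prob_space)
  have "Binv u \<in> constants_perp \<sigma> E"
    unfolding inverse_mod_constants_def using the_inv_into_into[OF inj] p im by blast
  then show "Binv u \<in> E" "(LINT x|\<sigma>. Binv u x) = 0"
    by (auto simp: constants_perp_iff)
  show "B (Binv u) = (\<lambda>x. u x - (LINT x|\<sigma>. u x))"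
    unfolding inverse_mod_constants_def using f_the_inv_into_f[OF inj] p im by blast
qed

text \<open>
  \<open>B (B\<^sup>-\<^sup>1 F) = F - \<integral>F\<close> turns the pairing of \<open>F\<close> with \<open>u\<close> into one of \<open>B\<^sup>-\<^sup>1 F\<close> with \<open>B u\<close>.
\<close>

lemma integral_Binv_B:
  assumes "F \<in> E" "u \<in> E"
  shows "(LINT x|\<sigma>. Binv F x * B u x)
    = (LINT x|\<sigma>. F x * u x) - (LINT x|\<sigma>. F x) * (LINT x|\<sigma>. u x)"
  using assms B_adjoint[of "Binv F" u] integrable[OF mult, of F u] integrable[of u]
  by (simp add: Binv_in B_Binv left_diff_distrib)

lemma integral_Binv_Binv:
  assumes "F \<in> E"
  shows "(LINT x|\<sigma>. F x * Binv (Binv F) x) = (LINT x|\<sigma>. Binv F x * Binv F x)"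
  using integral_Binv_B[of F "Binv (Binv F)"] assms by (simp add: Binv_in Binv_mean B_Binv)

text \<open>Young's inequality \<open>a b \<le> \<beta>/2 a\<^sup>2 + 1/(2\<beta>) b\<^sup>2\<close> with \<open>a = B\<^sup>-\<^sup>1 F\<close> and \<open>b = B u\<close>.\<close>

lemma quadratic_duality:
  assumes "F \<in> E" "(LINT x|\<sigma>. F x) = 1" "u \<in> E" "\<beta> > 0"
  shows "(LINT x|\<sigma>. F x * u x) - (LINT x|\<sigma>. u x)
    \<le> \<beta> / 2 * (LINT x|\<sigma>. F x * Binv (Binv F) x) + 1 / (2 * \<beta>) * (LINT x|\<sigma>. u x * B (B u) x)"
proof -
  have E: "Binv F \<in> E" "B u \<in> E"
    using assms by (auto intro: Binv_in B_in)
  have young: "a * b \<le> \<beta> / 2 * (a * a) + 1 / (2 * \<beta>) * (b * b)" for a b :: real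
  proof -
    have "0 \<le> (\<beta> * a - b)\<^sup>2 / (2 * \<beta>)"
      using assms by simp
    also have "\<dots> = \<beta> / 2 * (a * a) + 1 / (2 * \<beta>) * (b * b) - a * b"
      using assms by (simp add: field_simps power2_eq_square)
    finally show ?thesis by simp
  qed
  have "(LINT x|\<sigma>. Binv F x * B u x)
      \<le> (LINT x|\<sigma>. \<beta> / 2 * (Binv F x * Binv F x) + 1 / (2 * \<beta>) * (B u x * B u x))"
    using E by (intro integral_mono young integrable add mult const)
  also have "\<dots> = \<beta> / 2 * (LINT x|\<sigma>. Binv F x * Binv F x) + 1 / (2 * \<beta>) * (LINT x|\<sigma>. B u x * B u x)"
    using E integrable[OF mult, of "Binv F" "Binv F"] integrable[OF mult, of "B u" "B u"] by simp
  finally show ?thesis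
    using assms E by (simp add: integral_Binv_B integral_Binv_Binv B_adjoint)
qed

text \<open>
  The maximizer \<open>u = \<beta> B\<^sup>-\<^sup>2 F\<close> in the duality satisfies \<open>B u = \<beta> B\<^sup>-\<^sup>1 F\<close>, which is equality in
  Young's inequality. Its mean vanishes because the values of \<open>B\<^sup>-\<^sup>1\<close> are orthogonal to the
  constants.
\<close>

lemma quadratic_duality_equality:
  assumes u_def: "u = (\<lambda>x. \<beta> * Binv (Binv F) x)" and F: "F \<in> E" and \<beta>: "\<beta> > 0"
  shows "u \<in> E" and "(LINT x|\<sigma>. u x) = 0"
    and "1 / (2 * \<beta>) * (LINT x|\<sigma>. u x * B (B u) x)
      = \<beta> / 2 * (LINT x|\<sigma>. F x * Binv (Binv F) x)"
proof -
  have E: "Binv F \<in> E" "Binv (Binv F) \<in> E"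
    using F by (auto intro: Binv_in)
  show uE: "u \<in> E"
    unfolding u_def using E by (intro mult const)
  show "(LINT x|\<sigma>. u x) = 0"
    using F by (simp add: u_def Binv_in Binv_mean)
  have Bu: "B u = (\<lambda>x. \<beta> * Binv F x)"
    using E F by (simp add: u_def B_scale B_Binv Binv_mean)
  have "(LINT x|\<sigma>. u x * B (B u) x) = (LINT x|\<sigma>. B u x * B u x)"
    using uE by (simp add: B_adjoint B_in)
  also have "\<dots> = (LINT x|\<sigma>. \<beta>\<^sup>2 * (Binv F x * Binv F x))"
    by (simp add: Bu power2_eq_square mult_ac)
  also have "\<dots> = \<beta>\<^sup>2 * (LINT x|\<sigma>. F x * Binv (Binv F) x)"
    using F by (simp add: integral_Binv_Binv)
  finally show "1 / (2 * \<beta>) * (LINT x|\<sigma>. u x * B (B u) x)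
      = \<beta> / 2 * (LINT x|\<sigma>. F x * Binv (Binv F) x)"
    using \<beta> by (simp add: power2_eq_square)
qed

end


section \<open>Equivalence of the two inequalities\<close>

theorem theorem3:
  fixes n :: nat
    and \<A> :: "'a::t2_space chart set"
    and \<sigma> :: "'a measure"
    and B :: "('a \<Rightarrow> real) \<Rightarrow> ('a \<Rightarrow> real)"
    and \<alpha> :: "'a \<Rightarrow> real"
    and \<beta> :: real
  defines "CM \<equiv> C_infinity n \<A>"
    and "Binv \<equiv> inverse_mod_constants \<sigma> (C_infinity n \<A>) B"
  assumes "smooth_closed_manifold n \<A>"
    and "sets \<sigma> = sets borel"
    and "prob_space \<sigma>"
    and "linear_operator_on CM B"
    and "non_negative_on \<sigma> CM B"
    and "self_adjoint_on \<sigma> CM B"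
    and "{u \<in> CM. B u = (\<lambda>_. 0)} = {(\<lambda>_. c) | c. True}"
    and "bij_betw B (constants_perp \<sigma> CM) (constants_perp \<sigma> CM)"
    and "\<alpha> \<in> CM"
    and "\<beta> > 0"
  shows "(\<forall>F\<in>CM. (\<forall>x. F x > 0) \<and> (LINT x|\<sigma>. F x) = 1 \<longrightarrow>
            \<beta> / 2 * (LINT x|\<sigma>. F x * Binv (Binv F) x)
              \<le> (LINT x|\<sigma>. F x * ln (F x)) + (LINT x|\<sigma>. F x * \<alpha> x))
     \<longleftrightarrow>
         (\<forall>u\<in>CM. 1 / (2 * \<beta>) * (LINT x|\<sigma>. u x * B (B u) x)
              \<ge> ln (LINT x|\<sigma>. exp (u x - \<alpha> x)) - (LINT x|\<sigma>. u x))"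
proof -
  have compact: "compact (UNIV :: 'a set)" and atlas: "smooth_atlas n \<A>"
    using assms(3) by (auto simp: smooth_closed_manifold_def)
  interpret prob_space \<sigma> by fact
  have cont: "continuous_on UNIV f" if "f \<in> CM" for f
    using that C_infinity_continuous[OF atlas] by (simp add: CM_def)
  note int = integrable_continuous_compact[OF finite_measure_axioms compact \<open>sets \<sigma> = sets borel\<close>]
  note CM_const = C_infinity_const[of _ n \<A>, folded CM_def]
    and CM_add = C_infinity_add[of _ n \<A>, folded CM_def]
    and CM_mult = C_infinity_mult[of _ n \<A>, folded CM_def]
    and CM_exp = C_infinity_exp[of _ n \<A>, folded CM_def]
  interpret invertible_mod_constants \<sigma> CM B
    by unfold_locales (use assms CM_const CM_add CM_mult int[OF cont] in auto)
  have Binv_eq: "Binv = inverse_mod_constants \<sigma> CM B"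
    by (simp add: Binv_def CM_def)
  have minus_\<alpha>: "(\<lambda>x. u x - \<alpha> x) \<in> CM" if "u \<in> CM" for u
    using CM_add[OF that CM_mult[OF CM_const[of "-1"] \<open>\<alpha> \<in> CM\<close>]] by simp
  show ?thesis
  proof (intro iffI ballI impI; (elim conjE)?)
    fix u
    assume a: "\<forall>F\<in>CM. (\<forall>x. F x > 0) \<and> (LINT x|\<sigma>. F x) = 1 \<longrightarrow>
        \<beta> / 2 * (LINT x|\<sigma>. F x * Binv (Binv F) x)
          \<le> (LINT x|\<sigma>. F x * ln (F x)) + (LINT x|\<sigma>. F x * \<alpha> x)"
      and u: "u \<in> CM"
    define F where "F = (\<lambda>x. exp (u x - \<alpha> x - ln (LINT x|\<sigma>. exp (u x - \<alpha> x))))"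
    have F: "F \<in> CM"
      using CM_exp[OF CM_add[OF minus_\<alpha>[OF u] CM_const[of "- ln (LINT x|\<sigma>. exp (u x - \<alpha> x))"]]]
      by (simp add: F_def)
    have intF: "integrable \<sigma> (\<lambda>x. F x * v x)" if "v \<in> CM" for v
      using F that by (intro integrable mult)
    have F1: "(LINT x|\<sigma>. F x) = 1"
      and ent: "(LINT x|\<sigma>. F x * ln (F x))
        = (LINT x|\<sigma>. F x * (u x - \<alpha> x)) - ln (LINT x|\<sigma>. exp (u x - \<alpha> x))"
      using gibbs_density_equality[OF F_def integrable[OF CM_exp[OF minus_\<alpha>[OF u]]]
          intF[OF minus_\<alpha>[OF u]]] .
    have split: "(LINT x|\<sigma>. F x * (u x - \<alpha> x)) = (LINT x|\<sigma>. F x * u x) - (LINT x|\<sigma>. F x * \<alpha> x)"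
      using intF[OF u] intF[OF \<open>\<alpha> \<in> CM\<close>] by (simp add: right_diff_distrib)
    have "\<beta> / 2 * (LINT x|\<sigma>. F x * Binv (Binv F) x)
        \<le> (LINT x|\<sigma>. F x * ln (F x)) + (LINT x|\<sigma>. F x * \<alpha> x)"
    proof -
      have "\<forall>x. F x > 0" by (simp add: F_def)
      with a F F1 show ?thesis by blast
    qed
    then show "1 / (2 * \<beta>) * (LINT x|\<sigma>. u x * B (B u) x)
        \<ge> ln (LINT x|\<sigma>. exp (u x - \<alpha> x)) - (LINT x|\<sigma>. u x)"
      using quadratic_duality[OF F F1 u \<open>\<beta> > 0\<close>, folded Binv_eq] ent split by linarith
  next
    fix F
    assume b: "\<forall>u\<in>CM. 1 / (2 * \<beta>) * (LINT x|\<sigma>. u x * B (B u) x)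
        \<ge> ln (LINT x|\<sigma>. exp (u x - \<alpha> x)) - (LINT x|\<sigma>. u x)"
      and F: "F \<in> CM" and pos: "\<forall>x. F x > 0" and F1: "(LINT x|\<sigma>. F x) = 1"
    define u where "u = (\<lambda>x. \<beta> * Binv (Binv F) x)"
    note u = quadratic_duality_equality[OF u_def[unfolded Binv_eq] F \<open>\<beta> > 0\<close>, folded Binv_eq]
    have intF: "integrable \<sigma> (\<lambda>x. F x * v x)" if "v \<in> CM" for v
      using F that by (intro integrable mult)
    have "integrable \<sigma> (\<lambda>x. F x * ln (F x))"
      using pos by (intro int continuous_intros cont[OF F]) (auto simp: less_imp_neq[THEN not_sym])
    then have gibbs: "(LINT x|\<sigma>. F x * (u x - \<alpha> x)) - (LINT x|\<sigma>. F x * ln (F x))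
        \<le> ln (LINT x|\<sigma>. exp (u x - \<alpha> x))"
      using pos F F1 u(1) minus_\<alpha> CM_exp intF integrable by (intro gibbs_inequality) auto
    have split: "(LINT x|\<sigma>. F x * (u x - \<alpha> x)) = (LINT x|\<sigma>. F x * u x) - (LINT x|\<sigma>. F x * \<alpha> x)"
      using intF[OF u(1)] intF[OF \<open>\<alpha> \<in> CM\<close>] by (simp add: right_diff_distrib)
    have "(LINT x|\<sigma>. F x * u x) = (LINT x|\<sigma>. \<beta> * (F x * Binv (Binv F) x))"
      by (simp add: u_def mult_ac)
    then have "(LINT x|\<sigma>. F x * u x) = \<beta> * (LINT x|\<sigma>. F x * Binv (Binv F) x)"
      by simp
    moreover have "\<beta> / 2 * (LINT x|\<sigma>. F x * Binv (Binv F) x) \<ge> ln (LINT x|\<sigma>. exp (u x - \<alpha> x))"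
      using b[rule_format, OF u(1)] u(2,3) by linarith
    ultimately show "\<beta> / 2 * (LINT x|\<sigma>. F x * Binv (Binv F) x)
        \<le> (LINT x|\<sigma>. F x * ln (F x)) + (LINT x|\<sigma>. F x * \<alpha> x)"
      using gibbs split by (simp add: field_simps)
  qed
qed

end
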